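(* Let $P,Q\in\mathrm{Mat}_d(\mathbb{Q})$. Then $P,Q$ are irreducible if and only if $P$ and $Q$ are invertible and the characteristic polynomial of $P^{-1}Q$ is irreducible over $\mathbb{Q}$.
   Context: Matrices $P,Q\in\mathrm{Mat}_d(\mathbb{Q})$ are called irreducible if there are no non-trivial subspaces $U,V$ of $\mathbb{Q}^d$ of the same dimension (non-trivial meaning neither $\{0\}$ nor $\mathbb{Q}^d$) such that $PU\subseteq V$ and $QU\subseteq V$. *)

theory Defs
  imports "HOL-Analysis.Analysis" "HOL-Computational_Algebra.Polynomial_Factorial"
begin

text \<open>Characteristic polynomial det(X I - A) of a square matrix over a commutative ring.\<close>
definition charpoly :: "'a::comm_ring_1 ^'n ^'n \<Rightarrow> 'a poly" where
  "charpoly A = det (\<chi> i j. (if i = j then [:0, 1:] else 0) - [:A $ i $ j:])"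

text \<open>The pair (P,Q) of d x d rational matrices is irreducible: there are no
  subspaces U, V of Q^d of the same dimension, both different from {0} and Q^d,
  with P U \<subseteq> V and Q U \<subseteq> V.\<close>
definition irreducible_pair :: "rat ^'d ^'d \<Rightarrow> rat ^'d ^'d \<Rightarrow> bool" where
  "irreducible_pair P Q \<longleftrightarrow>
     \<not> (\<exists>U V :: (rat ^'d) set.
           vec.subspace U \<and> vec.subspace V \<and> vec.dim U = vec.dim V \<and>
           U \<noteq> {0} \<and> U \<noteq> UNIV \<and> V \<noteq> {0} \<and> V \<noteq> UNIV \<and>
           (\<lambda>x. P *v x) ` U \<subseteq> V \<and> (\<lambda>x. Q *v x) ` U \<subseteq> V)"

end

theory Submission
  imports Defs "HOL-Computational_Algebra.Field_as_Ring"
begin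

text \<open>When \<open>P\<close> is invertible, a reducing pair \<open>(U, V)\<close> must have \<open>V = P U\<close> (the dimensions
  agree), so reducing pairs are the same as non-trivial subspaces invariant under
  \<open>A = P\<^sup>-\<^sup>1 Q\<close>; when \<open>P\<close> or \<open>Q\<close> is singular, a kernel vector gives a reducing pair of lines.
  It remains to see that \<open>A\<close> has no non-trivial invariant subspace iff its characteristic
  polynomial \<open>\<chi>\<close> is irreducible. A non-zero invariant subspace \<open>U\<close> yields a vector \<open>w \<noteq> 0\<close>
  with \<open>p(A) w = 0\<close> for an irreducible \<open>p\<close> of degree \<open>\<le> dim U\<close>, and conversely such a \<open>w\<close>
  spans an invariant (Krylov) subspace of dimension \<open>\<le> deg p\<close>. The link to \<open>\<chi>\<close> is that
  \<open>p(A) w = 0\<close> with \<open>p\<close> irreducible and \<open>w \<noteq> 0\<close> forces \<open>p dvd \<chi>\<close>: writing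
  \<open>p(X) w = (X - A) y\<close> with \<open>deg y < deg p\<close>, Cramer's rule over the polynomial ring gives
  \<open>\<chi> y\<^sub>k = p \<cdot> (\<dots>)\<close>, so if \<open>p\<close> did not divide \<open>\<chi>\<close>, it would divide every \<open>y\<^sub>k\<close>, forcing
  \<open>y = 0\<close> and \<open>w = 0\<close>.\<close>

section \<open>Polynomials applied to a matrix\<close>

definition poly_mat_app :: "'a::field^'n^'n \<Rightarrow> 'a poly \<Rightarrow> 'a^'n \<Rightarrow> 'a^'n" where
  "poly_mat_app A p w = (\<Sum>i\<le>degree p. coeff p i *s ((*v) A ^^ i) w)"

lemma matrix_vector_mult_scalar_commute:
  fixes M :: "'a::comm_ring_1^'n^'m"
  shows "M *v (c *s x) = c *s (M *v x)"
  by (simp add: vec_eq_iff matrix_vector_mult_def sum_distrib_left algebra_simps)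

lemma poly_mat_app_bound:
  assumes "degree p \<le> n"
  shows "poly_mat_app A p w = (\<Sum>i\<le>n. coeff p i *s ((*v) A ^^ i) w)"
  unfolding poly_mat_app_def using assms
  by (intro sum.mono_neutral_left) (auto simp: coeff_eq_0)

lemma poly_mat_app_0 [simp]: "poly_mat_app A 0 w = 0"
  by (simp add: poly_mat_app_def)

lemma poly_mat_app_degree_0:
  "degree p = 0 \<Longrightarrow> poly_mat_app A p w = coeff p 0 *s w"
  by (simp add: poly_mat_app_def)

lemma poly_mat_app_pCons: "poly_mat_app A (pCons a p) w = a *s w + A *v poly_mat_app A p w"
proof -
  have "poly_mat_app A (pCons a p) w
      = (\<Sum>i\<le>Suc (degree p). coeff (pCons a p) i *s ((*v) A ^^ i) w)"
    by (rule poly_mat_app_bound) (simp add: degree_pCons_le)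
  also have "\<dots> = a *s w + (\<Sum>i\<le>degree p. coeff p i *s (A *v ((*v) A ^^ i) w))"
    by (subst sum.atMost_Suc_shift) simp
  also have "(\<Sum>i\<le>degree p. coeff p i *s (A *v ((*v) A ^^ i) w)) = A *v poly_mat_app A p w"
    by (simp add: poly_mat_app_def vec.sum vec.scale)
  finally show ?thesis .
qed

lemma poly_mat_app_add: "poly_mat_app A (p + q) w = poly_mat_app A p w + poly_mat_app A q w"
proof -
  let ?n = "max (degree p) (degree q)"
  have "poly_mat_app A (p + q) w = (\<Sum>i\<le>?n. coeff (p + q) i *s ((*v) A ^^ i) w)"
    by (rule poly_mat_app_bound) (simp add: degree_add_le)
  also have "\<dots> = poly_mat_app A p w + poly_mat_app A q w"
    by (simp add: poly_mat_app_bound[of p ?n] poly_mat_app_bound[of q ?n]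
        sum.distrib vec.scale_left_distrib)
  finally show ?thesis .
qed

lemma poly_mat_app_smult: "poly_mat_app A (smult c p) w = c *s poly_mat_app A p w"
proof -
  have "poly_mat_app A (smult c p) w = (\<Sum>i\<le>degree p. coeff (smult c p) i *s ((*v) A ^^ i) w)"
    by (rule poly_mat_app_bound) simp
  then show ?thesis
    by (simp add: poly_mat_app_def vec.scale_sum_right)
qed

lemma poly_mat_app_diff: "poly_mat_app A (p - q) w = poly_mat_app A p w - poly_mat_app A q w"
  using poly_mat_app_add[of A "p - q" q w] by simp

lemma poly_mat_app_mult: "poly_mat_app A (p * q) w = poly_mat_app A p (poly_mat_app A q w)"
  by (induct p rule: pCons_induct) (simp_all add: poly_mat_app_add poly_mat_app_smult poly_mat_app_pCons)

lemma poly_mat_app_monom: "poly_mat_app A (monom c n) w = c *s ((*v) A ^^ n) w"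
proof -
  have "poly_mat_app A (monom c n) w = (\<Sum>i\<le>n. coeff (monom c n) i *s ((*v) A ^^ i) w)"
    by (rule poly_mat_app_bound) (simp add: degree_monom_le)
  also have "\<dots> = (\<Sum>i\<le>n. if n = i then c *s ((*v) A ^^ i) w else 0)"
    by (intro sum.cong) (auto simp: coeff_monom)
  finally show ?thesis
    by simp
qed

lemma poly_mat_app_eq_0_degree_0:
  assumes "poly_mat_app A p w = 0" "p \<noteq> 0" "degree p = 0"
  shows "w = 0"
proof -
  have "coeff p 0 \<noteq> 0"
    using assms(2,3) leading_coeff_0_iff[of p] by simp
  moreover have "coeff p 0 *s w = 0"
    using assms(1) by (simp only: poly_mat_app_degree_0[OF assms(3)])
  ultimately show ?thesis
    by (simp add: vector_mul_eq_0)
qed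

section \<open>Invariant subspaces and annihilating polynomials\<close>

definition invariant_subspace :: "'a::field^'n^'n \<Rightarrow> ('a^'n) set \<Rightarrow> bool" where
  "invariant_subspace A U \<longleftrightarrow> vec.subspace U \<and> (\<forall>x\<in>U. A *v x \<in> U)"

lemma funpow_mem_invariant_subspace:
  assumes "invariant_subspace A U" "u \<in> U"
  shows "((*v) A ^^ i) u \<in> U"
  using assms by (induct i) (auto simp: invariant_subspace_def)

lemma exists_annihilating_poly:
  assumes U: "invariant_subspace A U" and u: "u \<in> U"
  shows "\<exists>h. h \<noteq> 0 \<and> degree h \<le> vec.dim U \<and> poly_mat_app A h u = 0"
proof -
  define k where "k = vec.dim U"
  define g where "g i = ((*v) A ^^ i) u" for i
  show ?thesis
  proof (cases "inj_on g {..k}")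
    case False
    then obtain a b where ab: "a < b" "b \<le> k" "g a = g b"
      unfolding inj_on_def by (metis atMost_iff linorder_neqE_nat)
    define h :: "'a poly" where "h = monom 1 b - monom 1 a"
    have "coeff h b = 1"
      using ab by (simp add: h_def coeff_monom)
    moreover have "degree h \<le> k"
      unfolding h_def using ab
      by (intro order.trans[OF degree_diff_le_max]) (auto intro: order.trans[OF degree_monom_le])
    moreover have "poly_mat_app A h u = 0"
      using ab by (simp add: h_def poly_mat_app_diff poly_mat_app_monom g_def)
    ultimately show ?thesis
      unfolding k_def by (metis coeff_0 zero_neq_one)
  next
    case True
    have "\<not> vec.independent (g ` {..k})"
    proof
      assume "vec.independent (g ` {..k})"
      moreover have "g ` {..k} \<subseteq> U"
        using funpow_mem_invariant_subspace[OF U u] by (auto simp: g_def)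
      ultimately have "card (g ` {..k}) \<le> k"
        unfolding k_def by (rule vec.independent_card_le_dim[rotated])
      with True show False
        by (simp add: card_image)
    qed
    then obtain c where c: "\<exists>v\<in>g ` {..k}. c v \<noteq> 0" "(\<Sum>v\<in>g ` {..k}. c v *s v) = 0"
      using vec.dependent_finite[of "g ` {..k}"] by auto
    define h :: "'a poly" where "h = (\<Sum>i\<le>k. monom (c (g i)) i)"
    have coeff_h: "coeff h j = (if j \<le> k then c (g j) else 0)" for j
      unfolding h_def coeff_sum by (simp add: coeff_monom)
    have deg_h: "degree h \<le> k"
      by (rule degree_le) (simp add: coeff_h)
    from c(1) obtain j where "j \<le> k" "c (g j) \<noteq> 0"
      by auto
    then have "h \<noteq> 0"
      by (metis coeff_0 coeff_h)
    moreover have "poly_mat_app A h u = (\<Sum>i\<le>k. c (g i) *s g i)"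
      by (simp add: poly_mat_app_bound[OF deg_h] coeff_h g_def)
    moreover have "\<dots> = (\<Sum>v\<in>g ` {..k}. c v *s v)"
      by (simp add: sum.reindex[OF True])
    ultimately show ?thesis
      using deg_h c(2) unfolding k_def by auto
  qed
qed

lemma exists_irreducible_annihilated_vector:
  fixes A :: "'a::field_gcd^'n^'n"
  shows "h \<noteq> 0 \<Longrightarrow> poly_mat_app A h u = 0 \<Longrightarrow> u \<noteq> 0 \<Longrightarrow>
     \<exists>p w. irreducible p \<and> p dvd h \<and> w \<noteq> 0 \<and> poly_mat_app A p w = 0"
proof (induct "degree h" arbitrary: h rule: less_induct)
  case less
  have "\<not> is_unit h"
    using poly_mat_app_eq_0_degree_0[of A h u] less.prems by (auto simp: is_unit_iff_degree)
  then obtain p where p: "p dvd h" "prime p"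
    using prime_divisor_exists[OF less.prems(1)] by auto
  then obtain q where h: "h = p * q"
    by (auto elim: dvdE)
  have irr: "irreducible p"
    using p(2) by (simp add: prime_elem_imp_irreducible)
  show ?case
  proof (cases "poly_mat_app A q u = 0")
    case True
    have "p \<noteq> 0" "q \<noteq> 0" "degree p > 0"
      using h less.prems(1) irr by (auto simp: irreducible_def is_unit_iff_degree)
    then have "degree q < degree h"
      by (simp add: h degree_mult_eq)
    then obtain p' w where "irreducible p'" "p' dvd q" "w \<noteq> 0" "poly_mat_app A p' w = 0"
      using less.hyps \<open>q \<noteq> 0\<close> True less.prems(3) by blast
    then show ?thesis
      unfolding h by (meson dvd_mult)
  next
    case False
    then show ?thesis
      using irr p(1) less.prems(2) by (auto simp: h poly_mat_app_mult)
  qed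
qed

lemma invariant_subspace_irreducible_annihilator:
  fixes A :: "'a::field_gcd^'n^'n"
  assumes U: "invariant_subspace A U" and "U \<noteq> {0}"
  shows "\<exists>p w. irreducible p \<and> degree p \<le> vec.dim U \<and> w \<noteq> 0 \<and> poly_mat_app A p w = 0"
proof -
  obtain u where u: "u \<in> U" "u \<noteq> 0"
    using assms by (auto simp: invariant_subspace_def vec.subspace_def)
  obtain h where h: "h \<noteq> 0" "degree h \<le> vec.dim U" "poly_mat_app A h u = 0"
    using exists_annihilating_poly[OF U u(1)] by blast
  obtain p w where "irreducible p" "p dvd h" "w \<noteq> 0" "poly_mat_app A p w = 0"
    using exists_irreducible_annihilated_vector[OF h(1) h(3) u(2)] by blast
  with h(1,2) show ?thesis
    by (meson dvd_imp_degree_le order.trans)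
qed

lemma krylov_invariant_subspace:
  assumes "poly_mat_app A p w = 0" and "p \<noteq> 0"
  shows "\<exists>W. invariant_subspace A W \<and> w \<in> W \<and> vec.dim W \<le> degree p"
proof -
  define D where "D = degree p"
  define W where "W = vec.span ((\<lambda>i. ((*v) A ^^ i) w) ` {..<D})"
  have in_W: "((*v) A ^^ i) w \<in> W" if "i \<le> D" for i
  proof (cases "i < D")
    case True
    then show ?thesis
      unfolding W_def by (intro vec.span_base) auto
  next
    case False
    with that have i: "i = D" by simp
    have "(\<Sum>i<Suc D. coeff p i *s ((*v) A ^^ i) w) = 0"
      using assms(1) by (simp add: poly_mat_app_def D_def lessThan_Suc_atMost)
    then have top: "lead_coeff p *s ((*v) A ^^ D) w = - (\<Sum>i<D. coeff p i *s ((*v) A ^^ i) w)"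
      by (simp add: D_def eq_neg_iff_add_eq_0 add.commute)
    have "((*v) A ^^ D) w = (1 / lead_coeff p) *s (lead_coeff p *s ((*v) A ^^ D) w)"
      using assms(2) by simp
    also have "\<dots> \<in> W"
      unfolding top W_def by (intro vec.span_scale vec.span_neg vec.span_sum vec.span_base) auto
    finally show ?thesis
      using i by simp
  qed
  have "vec.subspace {x. A *v x \<in> W}"
    unfolding vec.subspace_def W_def
    by (auto simp: matrix_vector_right_distrib matrix_vector_mult_scalar_commute
        intro: vec.span_add vec.span_scale vec.span_zero)
  moreover have "(\<lambda>i. ((*v) A ^^ i) w) ` {..<D} \<subseteq> {x. A *v x \<in> W}"
    using in_W[of "Suc _"] by auto
  ultimately have "\<forall>x\<in>W. A *v x \<in> W"
    using vec.span_minimal unfolding W_def by blast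
  moreover have "vec.dim W \<le> card ((\<lambda>i. ((*v) A ^^ i) w) ` {..<D})"
    unfolding W_def by (rule vec.dim_le_card) auto
  moreover have "card ((\<lambda>i. ((*v) A ^^ i) w) ` {..<D}) \<le> D"
    using card_image_le[of "{..<D}"] by simp
  ultimately show ?thesis
    using in_W[of 0] unfolding D_def invariant_subspace_def W_def by auto
qed

section \<open>Irreducible annihilators divide the characteristic polynomial\<close>

definition charmat :: "'a::comm_ring_1^'n^'n \<Rightarrow> 'a poly^'n^'n" where
  "charmat A = (\<chi> i j. (if i = j then [:0, 1:] else 0) - [:A $ i $ j:])"

lemma charpoly_eq_det_charmat: "charpoly A = det (charmat A)"
  by (simp add: charpoly_def charmat_def)

lemma degree_charmat_perm_prod:
  "degree (\<Prod>i\<in>UNIV. charmat A $ i $ p i) \<le> card {i. p i = i}"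
proof -
  have "degree (\<Prod>i\<in>UNIV. charmat A $ i $ p i) \<le> (\<Sum>i\<in>UNIV. degree (charmat A $ i $ p i))"
    using degree_prod_sum_le[of UNIV "\<lambda>i. charmat A $ i $ p i"] by (simp add: o_def)
  also have "\<dots> \<le> (\<Sum>i\<in>UNIV. if p i = i then 1 else 0)"
    by (intro sum_mono) (auto simp: charmat_def degree_diff_le)
  also have "\<dots> = card {i. p i = i}"
    by (simp add: sum.If_cases)
  finally show ?thesis .
qed

lemma degree_charpoly:
  fixes A :: "'a::field^'n^'n"
  shows "degree (charpoly A) = CARD('n)"
proof -
  let ?t = "\<lambda>p. of_int (sign p) * (\<Prod>i\<in>UNIV. charmat A $ i $ p i)"
  have cp: "charpoly A = (\<Sum>p\<in>{p. p permutes (UNIV::'n set)}. ?t p)"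
    unfolding charpoly_eq_det_charmat det_def ..
  have smult: "?t p = smult (of_int (sign p)) (\<Prod>i\<in>UNIV. charmat A $ i $ p i)" for p
    by (simp add: of_int_poly)
  have deg_t: "degree (?t p) \<le> card {i. p i = i}" for p
    unfolding smult using degree_charmat_perm_prod[of A p] by (simp add: degree_smult_le order.trans)
  have "card {i. p i = i} \<le> CARD('n)" for p :: "'n \<Rightarrow> 'n"
    by (simp add: card_mono)
  then have "degree (charpoly A) \<le> CARD('n)"
    unfolding cp by (intro degree_sum_le) (auto intro: order.trans[OF deg_t])
  moreover have "coeff (charpoly A) CARD('n) = 1"
  proof -
    \<comment> \<open>only the identity permutation has \<open>CARD('n)\<close> fixed points\<close>
    have "card {i. p i = i} < CARD('n)" if "p \<noteq> id" for p :: "'n \<Rightarrow> 'n"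
      using that by (intro psubset_card_mono) (auto simp: fun_eq_iff)
    then have "coeff (?t p) CARD('n) = 0" if "p \<noteq> id" for p
      using that deg_t[of p] by (intro coeff_eq_0) (meson le_less_trans)
    then have "coeff (charpoly A) CARD('n) = (\<Sum>p\<in>{id}. coeff (?t p) CARD('n))"
      unfolding cp coeff_sum
      by (intro sum.mono_neutral_right) (auto simp: finite_permutations permutes_id)
    also have "\<dots> = coeff (\<Prod>i\<in>UNIV. [:- (A $ i $ i), 1:]) CARD('n)"
      by (simp add: sign_id charmat_def)
    also have "\<dots> = 1"
    proof -
      have "degree (\<Prod>i\<in>UNIV. [:- (A $ i $ i), 1:]) = CARD('n)"
        by (subst degree_prod_eq_sum_degree) auto
      moreover have "lead_coeff (\<Prod>i\<in>UNIV. [:- (A $ i $ i), 1:]) = 1"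
        unfolding lead_coeff_prod by simp
      ultimately show ?thesis
        by simp
    qed
    finally show ?thesis .
  qed
  then have "CARD('n) \<le> degree (charpoly A)"
    by (intro le_degree) simp
  ultimately show ?thesis
    by simp
qed

lemma cramer_lemma_comm_ring:
  fixes M :: "'a::comm_ring_1^'n^'n"
  shows "det (\<chi> i. if i = k then M *v x else row i (transpose M)) = x$k * det M"
proof -
  let ?T = "transpose M"
  have Mx: "M *v x = (\<Sum>j\<in>UNIV. x$j *s row j ?T)"
    by (simp add: vec_eq_iff matrix_vector_mult_def row_def transpose_def sum_component mult.commute)
  have "det (\<chi> i. if i = k then M *v x else row i ?T)
      = (\<Sum>j\<in>UNIV. det (\<chi> i. if i = k then x$j *s row j ?T else row i ?T))"
    unfolding Mx by (rule det_linear_row_sum) simp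
  also have "\<dots> = (\<Sum>j\<in>UNIV. x$j * det (\<chi> i. if i = k then row j ?T else row i ?T))"
    by (simp add: det_row_mul)
  also have "\<dots> = (\<Sum>j\<in>UNIV. if j = k then x$k * det M else 0)"
  proof (intro sum.cong refl)
    fix j
    show "x$j * det (\<chi> i. if i = k then row j ?T else row i ?T) = (if j = k then x$k * det M else 0)"
    proof (cases "j = k")
      case True
      then have "(\<chi> i. if i = k then row j ?T else row i ?T) = ?T"
        by (simp add: vec_eq_iff row_def)
      with True show ?thesis
        by simp
    next
      case False
      then have "det (\<chi> i. if i = k then row j ?T else row i ?T) = 0"
        by (intro det_identical_rows[of k j]) (auto simp: row_def vec_eq_iff)
      with False show ?thesis
        by simp
    qed
  qed
  finally show ?thesis
    by simp
qed

definition const_poly_vec :: "'a::zero^'n \<Rightarrow> 'a poly^'n" where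
  "const_poly_vec w = (\<chi> k. [:w$k:])"

lemma const_poly_vec_0 [simp]: "const_poly_vec 0 = 0"
  by (simp add: const_poly_vec_def vec_eq_iff)

lemma charmat_mult_const_poly_vec:
  "charmat A *v const_poly_vec u = [:0,1:] *s const_poly_vec u - const_poly_vec (A *v u)"
proof -
  have "(charmat A *v const_poly_vec u) $ i = [:0, u$i:] - [:(A *v u) $ i:]" for i
  proof -
    have "(charmat A *v const_poly_vec u) $ i = (\<Sum>j\<in>UNIV. charmat A $ i $ j * [:u$j:])"
      by (simp add: matrix_vector_mult_def const_poly_vec_def)
    also have "\<dots> = (\<Sum>j\<in>UNIV. (if i = j then [:0, u$j:] else 0) - [:A$i$j * u$j:])"
      by (intro sum.cong) (auto simp: charmat_def algebra_simps)
    also have "\<dots> = [:0, u$i:] - [:(A *v u) $ i:]"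
      by (simp add: sum_subtractf sum_to_poly matrix_vector_mult_def)
    finally show ?thesis .
  qed
  then show ?thesis
    by (simp add: vec_eq_iff const_poly_vec_def)
qed

text \<open>\<open>divided_difference_vec A w p\<close> is \<open>((p(X) - p(A)) / (X - A)) w\<close>, computed by Horner's
  scheme on the coefficient list of \<open>p\<close>.\<close>

primrec divided_difference_vec_coeffs :: "'a::field^'n^'n \<Rightarrow> 'a^'n \<Rightarrow> 'a list \<Rightarrow> 'a poly^'n"
where
  "divided_difference_vec_coeffs A w [] = 0"
| "divided_difference_vec_coeffs A w (a # as) =
     [:0,1:] *s divided_difference_vec_coeffs A w as + const_poly_vec (poly_mat_app A (Poly as) w)"

definition divided_difference_vec :: "'a::field^'n^'n \<Rightarrow> 'a^'n \<Rightarrow> 'a poly \<Rightarrow> 'a poly^'n" where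
  "divided_difference_vec A w p = divided_difference_vec_coeffs A w (coeffs p)"

lemma divided_difference_vec_pCons:
  "divided_difference_vec A w (pCons a q)
     = [:0,1:] *s divided_difference_vec A w q + const_poly_vec (poly_mat_app A q w)"
proof (cases "a = 0 \<and> q = 0")
  case False
  then have "coeffs (pCons a q) = a # coeffs q"
    by (auto simp: cCons_def)
  then show ?thesis
    by (simp add: divided_difference_vec_def)
qed (simp add: divided_difference_vec_def)

lemma charmat_mult_divided_difference_vec:
  "charmat A *v divided_difference_vec A w p = p *s const_poly_vec w - const_poly_vec (poly_mat_app A p w)"
proof (induct p rule: pCons_induct)
  case 0
  then show ?case
    by (simp add: divided_difference_vec_def)
next
  case (pCons a q)
  have "charmat A *v divided_difference_vec A w (pCons a q)
      = [:0,1:] *s (charmat A *v divided_difference_vec A w q)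
        + charmat A *v const_poly_vec (poly_mat_app A q w)"
    by (simp add: divided_difference_vec_pCons matrix_vector_right_distrib
        matrix_vector_mult_scalar_commute)
  also have "\<dots> = [:0,1:] *s (q *s const_poly_vec w - const_poly_vec (poly_mat_app A q w))
      + ([:0,1:] *s const_poly_vec (poly_mat_app A q w) - const_poly_vec (A *v poly_mat_app A q w))"
    by (simp only: pCons.hyps charmat_mult_const_poly_vec)
  also have "\<dots> = pCons a q *s const_poly_vec w - const_poly_vec (poly_mat_app A (pCons a q) w)"
    by (simp add: vec_eq_iff const_poly_vec_def poly_mat_app_pCons)
  finally show ?case .
qed

lemma divided_difference_vec_degree:
  "degree (divided_difference_vec A w p $ k) \<le> degree p - 1 \<and>
   coeff (divided_difference_vec A w p $ k) (degree p - 1) =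
     (if degree p = 0 then 0 else lead_coeff p * w $ k)"
proof (induct p rule: pCons_induct)
  case 0
  then show ?case
    by (simp add: divided_difference_vec_def)
next
  case (pCons a q)
  have y: "divided_difference_vec A w (pCons a q) $ k
      = pCons (poly_mat_app A q w $ k) (divided_difference_vec A w q $ k)"
    by (simp add: divided_difference_vec_pCons const_poly_vec_def)
  show ?case
  proof (cases "degree q = 0")
    case True
    with pCons.hyps(2) have "degree (divided_difference_vec A w q $ k) = 0"
      "coeff (divided_difference_vec A w q $ k) 0 = 0"
      by auto
    then have "divided_difference_vec A w q $ k = 0"
      by (metis leading_coeff_0_iff)
    with True pCons.hyps(1) show ?thesis
      by (auto simp: y poly_mat_app_degree_0)
  next
    case False
    then have "q \<noteq> 0"
      by auto
    have "degree (pCons (poly_mat_app A q w $ k) (divided_difference_vec A w q $ k)) \<le> degree q"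
      using pCons.hyps(2) False
      by (metis Suc_diff_1 Suc_le_mono bot_nat_0.not_eq_extremum degree_pCons_le le_trans)
    moreover have "coeff (pCons (poly_mat_app A q w $ k) (divided_difference_vec A w q $ k)) (degree q)
        = lead_coeff q * w $ k"
      using pCons.hyps(2) False by (metis Suc_diff_1 bot_nat_0.not_eq_extremum coeff_pCons_Suc)
    ultimately show ?thesis
      using \<open>q \<noteq> 0\<close> by (simp add: y)
  qed
qed

lemma irreducible_annihilator_dvd_charpoly:
  fixes A :: "'a::field_gcd^'n^'n"
  assumes irr: "irreducible p" and "poly_mat_app A p w = 0" and "w \<noteq> 0"
  shows "p dvd charpoly A"
proof (rule ccontr)
  assume not_dvd: "\<not> p dvd charpoly A"
  let ?y = "divided_difference_vec A w p"
  have y: "charmat A *v ?y = p *s const_poly_vec w"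
    using charmat_mult_divided_difference_vec[of A w p] assms(2) by simp
  have "p \<noteq> 0" "degree p > 0"
    using irr by (auto simp: irreducible_def is_unit_iff_degree)
  have "w $ k = 0" for k
  proof -
    have "?y $ k * charpoly A
        = det (\<chi> i. if i = k then charmat A *v ?y else row i (transpose (charmat A)))"
      by (simp add: cramer_lemma_comm_ring charpoly_eq_det_charmat)
    also have "\<dots> = p * det (\<chi> i. if i = k then const_poly_vec w else row i (transpose (charmat A)))"
      unfolding y by (rule det_row_mul)
    finally have "p dvd ?y $ k * charpoly A"
      by simp
    then have "p dvd ?y $ k"
      using not_dvd irr by (simp add: prime_elem_dvd_mult_iff prime_elem_iff_irreducible)
    have "?y $ k = 0"
    proof (rule ccontr)
      assume "?y $ k \<noteq> 0"
      with \<open>p dvd ?y $ k\<close> have "degree p \<le> degree (?y $ k)"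
        by (rule dvd_imp_degree_le)
      with divided_difference_vec_degree[of A w p k] \<open>degree p > 0\<close> show False
        by linarith
    qed
    then show ?thesis
      using divided_difference_vec_degree[of A w p k] \<open>p \<noteq> 0\<close> \<open>degree p > 0\<close> by simp
  qed
  with \<open>w \<noteq> 0\<close> show False
    by (simp add: vec_eq_iff)
qed

section \<open>Irreducibility of the characteristic polynomial\<close>

lemma irreducible_if_irreducible_dvd:
  fixes p q :: "'a::field poly"
  assumes "irreducible p" "p dvd q" "q \<noteq> 0" "degree q \<le> degree p"
  shows "irreducible q"
proof -
  obtain r where q: "q = p * r"
    using assms(2) by (auto elim: dvdE)
  have "p \<noteq> 0" "r \<noteq> 0"
    using assms(3) q by auto
  then have "is_unit r"
    using assms(4) by (simp add: q degree_mult_eq is_unit_iff_degree)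
  then show ?thesis
    using assms(1) by (simp add: q mult.commute[of p] irreducible_mult_unit_left)
qed

lemma dim_less_card_if_proper_subspace:
  assumes "vec.subspace U" "U \<noteq> (UNIV :: ('a::field^'n) set)"
  shows "vec.dim U < CARD('n)"
proof -
  have "vec.span U = U"
    using assms(1) by (simp only: vec.span_eq_iff)
  then have "vec.span U \<subset> vec.span (UNIV :: ('a^'n) set)"
    using assms(2) by (simp only: vec.span_UNIV) blast
  then have "vec.dim U < vec.dim (UNIV :: ('a^'n) set)"
    by (rule vec.dim_psubset)
  then show ?thesis
    by (simp add: vec_dim_card card_cart_basis)
qed

lemma invariant_subspace_trivial_if_irreducible_charpoly:
  fixes A :: "'a::field_gcd^'n^'n"
  assumes irr: "irreducible (charpoly A)" and U: "invariant_subspace A U" "U \<noteq> UNIV"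
  shows "U = {0}"
proof (rule ccontr)
  assume "U \<noteq> {0}"
  with U(1) obtain p w where p: "irreducible p" "degree p \<le> vec.dim U" "w \<noteq> 0"
      "poly_mat_app A p w = 0"
    by (blast dest: invariant_subspace_irreducible_annihilator)
  have "vec.dim U < CARD('n)"
    using U unfolding invariant_subspace_def by (blast intro: dim_less_card_if_proper_subspace)
  with p(2) have "degree p < degree (charpoly A)"
    by (simp add: degree_charpoly)
  moreover have "p dvd charpoly A"
    using p by (blast intro: irreducible_annihilator_dvd_charpoly)
  then have "charpoly A dvd p"
    using irreducibleD'[OF irr] irreducible_not_unit[OF p(1)] by blast
  then have "degree (charpoly A) \<le> degree p"
    using p(1) by (intro dvd_imp_degree_le) auto
  ultimately show False
    by simp
qed

lemma irreducible_charpoly_if_invariant_subspaces_trivial: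
  fixes A :: "'a::field_gcd^'n^'n"
  assumes trivial: "\<forall>U. invariant_subspace A U \<longrightarrow> U = {0} \<or> U = UNIV"
  shows "irreducible (charpoly A)"
proof -
  have "axis i (1::'a) \<noteq> 0" for i :: 'n
    by (simp add: axis_eq_0_iff)
  then have "(UNIV :: ('a^'n) set) \<noteq> {0}"
    by (metis UNIV_I singletonD)
  moreover have "invariant_subspace A UNIV"
    by (simp add: invariant_subspace_def)
  ultimately obtain p w where p: "irreducible p" "w \<noteq> 0" "poly_mat_app A p w = 0"
    by (blast dest: invariant_subspace_irreducible_annihilator)
  then have "p \<noteq> 0"
    by auto
  then obtain W where W: "invariant_subspace A W" "w \<in> W" "vec.dim W \<le> degree p"
    using krylov_invariant_subspace[OF p(3)] by blast
  have "W = UNIV"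
    using trivial W(1,2) p(2) by blast
  with W(3) have "degree (charpoly A) \<le> degree p"
    by (simp add: degree_charpoly vec_dim_card card_cart_basis)
  moreover have "charpoly A \<noteq> 0"
    using degree_charpoly[of A] zero_less_card_finite[where 'a='n] by auto
  moreover have "p dvd charpoly A"
    using p by (blast intro: irreducible_annihilator_dvd_charpoly)
  ultimately show ?thesis
    using p(1) irreducible_if_irreducible_dvd by blast
qed

theorem irreducible_charpoly_iff_invariant_subspaces_trivial:
  fixes A :: "'a::field_gcd^'n^'n"
  shows "irreducible (charpoly A) \<longleftrightarrow> (\<forall>U. invariant_subspace A U \<longrightarrow> U = {0} \<or> U = UNIV)"
  using invariant_subspace_trivial_if_irreducible_charpoly
    irreducible_charpoly_if_invariant_subspaces_trivial by auto

section \<open>Irreducible pairs\<close>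

lemma singular_imp_not_irreducible_pair:
  fixes P Q :: "rat^'d^'d"
  assumes "CARD('d) \<ge> 2" and "v \<noteq> 0" and "P *v v = 0 \<or> Q *v v = 0"
  shows "\<not> irreducible_pair P Q"
proof -
  \<comment> \<open>one of \<open>P v\<close>, \<open>Q v\<close> vanishes, so both lie on the line spanned by \<open>z\<close>\<close>
  define z where "z = (if P *v v = 0 then (if Q *v v = 0 then v else Q *v v) else P *v v)"
  have "z \<noteq> 0"
    using assms(2) by (simp add: z_def)
  have line_dim: "vec.dim (vec.span {x}) = 1" if "x \<noteq> 0" for x :: "rat^'d"
    using that by simp
  have line_proper: "vec.span {x} \<noteq> UNIV" if "x \<noteq> 0" for x :: "rat^'d"
  proof
    assume "vec.span {x} = UNIV"
    with line_dim[OF that] have "vec.dim (UNIV :: (rat^'d) set) = 1"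
      by simp
    with assms(1) show False
      by (simp add: vec_dim_card card_cart_basis)
  qed
  have line_nonzero: "vec.span {x} \<noteq> {0}" if "x \<noteq> 0" for x :: "rat^'d"
    using that vec.span_base[of x "{x}"] by auto
  have maps_to: "(\<lambda>x. M *v x) ` vec.span {v} \<subseteq> vec.span {z}" if "M *v v \<in> vec.span {z}" for M
    using that
    by (auto simp: vec.span_singleton matrix_vector_mult_scalar_commute vec.span_scale)
  have PQ: "P *v v \<in> vec.span {z}" "Q *v v \<in> vec.span {z}"
    using assms(3) by (auto simp: z_def vec.span_zero intro: vec.span_base)
  show ?thesis
    unfolding irreducible_pair_def not_not
    by (rule exI[of _ "vec.span {v}"], rule exI[of _ "vec.span {z}"])
      (intro conjI vec.subspace_span maps_to PQ line_proper line_nonzero assms(2) \<open>z \<noteq> 0\<close>;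
        simp add: line_dim assms(2) \<open>z \<noteq> 0\<close>)
qed

lemma irreducible_pair_imp_invertible:
  fixes P Q :: "rat^'d^'d"
  assumes "CARD('d) \<ge> 2" and "irreducible_pair P Q"
  shows "invertible P" "invertible Q"
  using singular_imp_not_irreducible_pair[OF assms(1)] assms(2)
  unfolding invertible_left_inverse matrix_left_invertible_ker by blast+

lemma matrix_inv_inverse:
  assumes "invertible (P::'a::semiring_1^'n^'n)"
  shows "P ** matrix_inv P = mat 1" "matrix_inv P ** P = mat 1"
proof -
  from assms obtain P' where "P ** P' = mat 1 \<and> P' ** P = mat 1"
    unfolding invertible_def by blast
  then have "P ** matrix_inv P = mat 1 \<and> matrix_inv P ** P = mat 1"
    unfolding matrix_inv_def by (rule someI)
  then show "P ** matrix_inv P = mat 1" "matrix_inv P ** P = mat 1"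
    by auto
qed

lemma invertible_image_subspace:
  fixes P :: "'a::field^'n^'n"
  assumes "invertible P" "vec.subspace U"
  shows "vec.subspace ((*v) P ` U)" "vec.dim ((*v) P ` U) = vec.dim U"
    "(*v) P ` U = {0} \<longleftrightarrow> U = {0}" "(*v) P ` U = UNIV \<longleftrightarrow> U = UNIV"
proof -
  have inj: "inj ((*v) P)"
    by (rule inj_matrix_vector_mult[OF assms(1)])
  have surj: "surj ((*v) P)"
    using assms(1) by (simp only: invertible_right_inverse matrix_right_invertible_surjective)
  show "vec.subspace ((*v) P ` U)"
    using vec.subspace_image[OF assms(2)] by simp
  show "vec.dim ((*v) P ` U) = vec.dim U"
    using vec.dim_image_eq[OF matrix_vector_mul_linear_gen, of P U] inj
    by (simp add: inj_on_subset)
  show "(*v) P ` U = {0} \<longleftrightarrow> U = {0}"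
    using inj_image_eq_iff[OF inj, of U "{0}"] by simp
  show "(*v) P ` U = UNIV \<longleftrightarrow> U = UNIV"
    using inj_image_eq_iff[OF inj, of U UNIV] surj by simp
qed

lemma matrix_inv_mult_mem_iff:
  fixes P Q :: "'a::field^'n^'n"
  assumes "invertible P"
  shows "(matrix_inv P ** Q) *v x \<in> U \<longleftrightarrow> Q *v x \<in> (*v) P ` U"
proof -
  have "Q *v x = P *v ((matrix_inv P ** Q) *v x)"
    by (simp add: matrix_vector_mul_assoc matrix_mul_assoc matrix_inv_inverse[OF assms])
  then show ?thesis
    using inj_matrix_vector_mult[OF assms] by (auto dest: injD)
qed

lemma irreducible_pair_iff_invariant_subspaces_trivial:
  fixes P Q :: "rat^'d^'d"
  assumes P: "invertible P"
  shows "irreducible_pair P Q \<longleftrightarrow>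
    (\<forall>U. invariant_subspace (matrix_inv P ** Q) U \<longrightarrow> U = {0} \<or> U = UNIV)"
proof
  assume ip: "irreducible_pair P Q"
  show "\<forall>U. invariant_subspace (matrix_inv P ** Q) U \<longrightarrow> U = {0} \<or> U = UNIV"
  proof (intro allI impI)
    fix U assume "invariant_subspace (matrix_inv P ** Q) U"
    then have U: "vec.subspace U" "(*v) Q ` U \<subseteq> (*v) P ` U"
      by (auto simp: invariant_subspace_def matrix_inv_mult_mem_iff[OF P])
    note PU = invertible_image_subspace[OF P U(1)]
    show "U = {0} \<or> U = UNIV"
    proof (rule ccontr)
      assume "\<not> (U = {0} \<or> U = UNIV)"
      with U PU have pair: "vec.subspace U \<and> vec.subspace ((*v) P ` U) \<and> vec.dim U = vec.dim ((*v) P ` U) \<and>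
          U \<noteq> {0} \<and> U \<noteq> UNIV \<and> (*v) P ` U \<noteq> {0} \<and> (*v) P ` U \<noteq> UNIV \<and>
          (*v) P ` U \<subseteq> (*v) P ` U \<and> (*v) Q ` U \<subseteq> (*v) P ` U"
        by simp
      have "\<not> irreducible_pair P Q"
        unfolding irreducible_pair_def not_not
        by (rule exI[of _ U], rule exI[of _ "(*v) P ` U"]) (fact pair)
      with ip show False
        by contradiction
    qed
  qed
next
  assume trivial: "\<forall>U. invariant_subspace (matrix_inv P ** Q) U \<longrightarrow> U = {0} \<or> U = UNIV"
  show "irreducible_pair P Q"
    unfolding irreducible_pair_def
  proof (rule notI, elim exE conjE)
    fix U V
    assume U: "vec.subspace U" and V: "vec.subspace V" and dim: "vec.dim U = vec.dim V"
      and "U \<noteq> {0}" "U \<noteq> UNIV" "V \<noteq> {0}" "V \<noteq> UNIV"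
      and PUV: "(*v) P ` U \<subseteq> V" and QUV: "(*v) Q ` U \<subseteq> V"
    note PU = invertible_image_subspace[OF P U]
    \<comment> \<open>equal dimensions force \<open>V = P U\<close>\<close>
    have "(*v) P ` U = V"
      using PU V dim PUV by (intro vec.subspace_dim_equal) auto
    with QUV U have "invariant_subspace (matrix_inv P ** Q) U"
      by (auto simp: invariant_subspace_def matrix_inv_mult_mem_iff[OF P])
    with trivial \<open>U \<noteq> {0}\<close> \<open>U \<noteq> UNIV\<close> show False
      by blast
  qed
qed

theorem theorem5p2:
  fixes P Q :: "rat ^'d ^'d"
  assumes "CARD('d) \<ge> 2"
  shows "irreducible_pair P Q \<longleftrightarrow>
           invertible P \<and> invertible Q \<and> irreducible (charpoly (matrix_inv P ** Q))"
proof
  assume ip: "irreducible_pair P Q"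
  then have "invertible P" "invertible Q"
    using irreducible_pair_imp_invertible[OF assms] by blast+
  with ip show "invertible P \<and> invertible Q \<and> irreducible (charpoly (matrix_inv P ** Q))"
    by (simp add: irreducible_pair_iff_invariant_subspaces_trivial
        irreducible_charpoly_iff_invariant_subspaces_trivial)
qed (simp add: irreducible_pair_iff_invariant_subspaces_trivial
      irreducible_charpoly_iff_invariant_subspaces_trivial)

end
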